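(* Let $D$ be an oriented graph missing $2$ disjoint stars. If the dependency digraph $\Delta$ of $D$ has no isolated vertex, then $D$ satisfies the second neighborhood conjecture, that is, there is a vertex $v\in V(D)$ with $d^+_D(v)\le d^{++}_D(v)$.
   Context: All digraphs are finite. An oriented graph is a digraph without loops and without digons (directed cycles of length two). Write $x\rightarrow y$ if $(x,y)$ is an arc. $N^+(v)$ is the set of out-neighbors of $v$ and $N^{++}(v)$ is the set of vertices at distance exactly $2$ from $v$ (reached from $v$ by a directed path of length 2 but not by one of length 0 or 1); $d^+(v)=|N^+(v)|$, $d^{++}(v)=|N^{++}(v)|$. For distinct vertices $x,y$ of $D$, $xy$ is a missing edge if neither $(x,y)$ nor $(y,x)$ is an arc of $D$. The missing graph of $D$ is the graph whose edges are the missing edges of $D$ and whose vertices are the vertices of $D$ that are not adjacent to all other vertices. A star of center $x$ is a graph whose edge set has the form $\{a_ix : i=1,\dots,k\}$ with $k\ge 1$, the $a_i$ distinct and different from $x$. $D$ is missing 2 disjoint stars if its missing graph is the union of two vertex-disjoint stars (equivalently, $D$ is obtained from a tournament by deleting the edges of two vertex-disjoint stars). Dependency digraph: for missing edges $e$ and $e'$ of $D$, $e$ loses to $e'$ if the endpoints can be named $e=x_1y_1$, $e'=x_2y_2$ so that $x_1\rightarrow x_2$, $y_2\notin N^+(x_1)\cup N^{++}(x_1)$, $y_1\rightarrow y_2$ and $x_2\notin N^+(y_1)\cup N^{++}(y_1)$. The dependency digraph $\Delta$ of $D$ has the missing edges of $D$ as vertices, and an arc $(e,e')$ whenever $e$ loses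 to $e'$ (digons in $\Delta$ are allowed). A vertex of $\Delta$ is isolated if it has in-degree $0$ and out-degree $0$ in $\Delta$. *)

theory Defs
  imports "Graph_Theory.Pair_Digraph"
begin

locale oriented_graph = pair_digraph +
  assumes no_digons: "(u, v) \<in> parcs G \<Longrightarrow> (v, u) \<notin> parcs G"

definition out_nbrs :: "'a pair_pre_digraph \<Rightarrow> 'a \<Rightarrow> 'a set" where
  "out_nbrs D v = {w \<in> pverts D. (v, w) \<in> parcs D}"

definition second_out_nbrs :: "'a pair_pre_digraph \<Rightarrow> 'a \<Rightarrow> 'a set" where
  "second_out_nbrs D v =
     {w \<in> pverts D. w \<noteq> v \<and> (v, w) \<notin> parcs D \<and> (\<exists>u. (v, u) \<in> parcs D \<and> (u, w) \<in> parcs D)}"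

definition missing_edge :: "'a pair_pre_digraph \<Rightarrow> 'a \<Rightarrow> 'a \<Rightarrow> bool" where
  "missing_edge D x y \<longleftrightarrow>
     x \<in> pverts D \<and> y \<in> pverts D \<and> x \<noteq> y \<and> (x, y) \<notin> parcs D \<and> (y, x) \<notin> parcs D"

definition missing_edges :: "'a pair_pre_digraph \<Rightarrow> 'a set set" where
  "missing_edges D = {{x, y} | x y. missing_edge D x y}"

text \<open>Undirected graphs are pairs of a vertex set and a set of two-element edges, so that
  the edge \<open>xy\<close> is the unordered \<open>{x, y}\<close>.\<close>

type_synonym 'a ugraph = "'a set \<times> 'a set set"

definition missing_graph :: "'a pair_pre_digraph \<Rightarrow> 'a ugraph" where
  "missing_graph D = ({x \<in> pverts D. \<exists>y. missing_edge D x y}, missing_edges D)"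

definition star_of_center :: "'a \<Rightarrow> 'a ugraph \<Rightarrow> bool" where
  "star_of_center x S \<longleftrightarrow>
     (\<exists>A. finite A \<and> A \<noteq> {} \<and> x \<notin> A \<and> S = (insert x A, {{a, x} | a. a \<in> A}))"

definition missing_two_disjoint_stars :: "'a pair_pre_digraph \<Rightarrow> bool" where
  "missing_two_disjoint_stars D \<longleftrightarrow>
     (\<exists>x y S T. star_of_center x S \<and> star_of_center y T \<and> fst S \<inter> fst T = {} \<and>
        missing_graph D = (fst S \<union> fst T, snd S \<union> snd T))"

definition loses_to :: "'a pair_pre_digraph \<Rightarrow> 'a set \<Rightarrow> 'a set \<Rightarrow> bool" where
  "loses_to D e e' \<longleftrightarrow>
     (\<exists>x1 y1 x2 y2. e = {x1, y1} \<and> e' = {x2, y2} \<and>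
        (x1, x2) \<in> parcs D \<and> y2 \<notin> out_nbrs D x1 \<union> second_out_nbrs D x1 \<and>
        (y1, y2) \<in> parcs D \<and> x2 \<notin> out_nbrs D y1 \<union> second_out_nbrs D y1)"

definition dependency_digraph :: "'a pair_pre_digraph \<Rightarrow> 'a set pair_pre_digraph" where
  "dependency_digraph D =
     \<lparr> pverts = missing_edges D,
       parcs = {(e, e'). e \<in> missing_edges D \<and> e' \<in> missing_edges D \<and> loses_to D e e'} \<rparr>"

definition isolated_vertex :: "'a pair_pre_digraph \<Rightarrow> 'a \<Rightarrow> bool" where
  "isolated_vertex H v \<longleftrightarrow>
     v \<in> pverts H \<and> in_degree (with_proj H) v = 0 \<and> out_degree (with_proj H) v = 0"

definition satisfies_SNC :: "'a pair_pre_digraph \<Rightarrow> bool" where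
  "satisfies_SNC D \<longleftrightarrow>
     (\<exists>v \<in> pverts D. card (out_nbrs D v) \<le> card (second_out_nbrs D v))"

end

theory Submission
  imports Defs
begin

text \<open>
  Let \<open>x\<close>, \<open>y\<close> be the centres of the stars, with leaf sets \<open>A\<close>, \<open>B\<close> and \<open>x \<rightarrow> y\<close>. A losing
  relation between \<open>ax\<close> and \<open>by\<close> forces the square \<open>x \<rightarrow> y \<rightarrow> a \<rightarrow> b \<rightarrow> x\<close>; since no vertex of
  \<open>\<Delta>\<close> is isolated, \<open>y\<close> dominates \<open>A\<close> and \<open>B\<close> dominates \<open>x\<close>.

  Complete \<open>D\<close> to a tournament: a missing edge \<open>uv\<close> gets the orientation \<open>u \<rightarrow> v\<close> if every
  in-neighbour of \<open>u\<close> reaches \<open>v\<close> in at most two steps, and edges with no such orientation are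
  oriented towards the centre. Take a median order, with \<open>x\<close> as far to the right as possible, and
  redirect the missing edges at its last vertex \<open>f\<close> towards \<open>f\<close>. By Havet and Thomasse, \<open>f\<close> has at
  least as many good vertices (second out-neighbours reached by a path that goes forward after its
  first arc) as out-neighbours. Every good vertex is a second out-neighbour of \<open>f\<close> in \<open>D\<close>, except
  possibly \<open>y\<close> if \<open>f \<in> A\<close>, and \<open>x\<close> if \<open>f = y\<close>. If \<open>f\<close> is not as desired, then equality holds in
  their theorem, the exceptional vertex is good, and every second out-neighbour of \<open>f\<close> is good; in
  particular \<open>x\<close> is good in both cases. Moving the vertices that are neither good nor out-neighbours,
  followed by \<open>f\<close>, to the front (sedimentation) then gives another median order in which \<open>x\<close> has
  moved to the right, a contradiction.
\<close>

section \<open>Forward arcs of an order and local medians\<close>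

lemma length_filter_mono:
  assumes "\<And>v. v \<in> set xs \<Longrightarrow> P v \<Longrightarrow> Q v"
  shows "length (filter P xs) \<le> length (filter Q xs)"
  using assms by (induction xs) auto

lemma length_filter_split:
  "length (filter P xs) = length (filter P (filter B xs)) + length (filter P (filter (\<lambda>v. \<not> B v) xs))"
  by (induction xs) auto

primrec fwd :: "('a \<Rightarrow> 'a \<Rightarrow> bool) \<Rightarrow> 'a list \<Rightarrow> nat" where
  "fwd T [] = 0"
| "fwd T (v # vs) = length (filter (T v) vs) + fwd T vs"

lemma fwd_snoc: "fwd T (vs @ [v]) = fwd T vs + length (filter (\<lambda>u. T u v) vs)"
  by (induction vs) auto

text \<open>Only the pairs formed by \<open>v\<close> and a member of \<open>ys\<close> change their
  order.\<close>

lemma fwd_move: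
  "fwd T (xs @ ys @ v # zs) + length (filter (T v) ys)
   = fwd T (xs @ v # ys @ zs) + length (filter (\<lambda>u. T u v) ys)"
proof (induction xs)
  case Nil
  show ?case by (induction ys) auto
qed auto

text \<open>One half of the feedback property of median orders, the half about the last vertex of an
  interval.\<close>

definition locally_median :: "('a \<Rightarrow> 'a \<Rightarrow> bool) \<Rightarrow> 'a list \<Rightarrow> bool" where
  "locally_median T L \<longleftrightarrow> (\<forall>xs ys v zs. L = xs @ ys @ v # zs \<longrightarrow>
     length (filter (T v) ys) \<le> length (filter (\<lambda>u. T u v) ys))"

definition sediment :: "('a \<Rightarrow> bool) \<Rightarrow> 'a list \<Rightarrow> 'a list" where
  "sediment B L = filter B L @ filter (\<lambda>v. \<not> B v) L"

lemma fwd_max_imp_locally_median: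
  assumes "\<And>L'. distinct L' \<Longrightarrow> set L' = set L \<Longrightarrow> fwd T L' \<le> fwd T L" and "distinct L"
  shows "locally_median T L"
  unfolding locally_median_def
proof (intro allI impI)
  fix xs ys v zs assume L: "L = xs @ ys @ v # zs"
  have "fwd T (xs @ v # ys @ zs) \<le> fwd T L"
    using assms L by (intro assms(1)) auto
  with fwd_move[of T xs ys v zs] L
  show "length (filter (T v) ys) \<le> length (filter (\<lambda>u. T u v) ys)" by simp
qed

section \<open>Counting and sedimentation with marked vertices\<close>

text \<open>In the intended instance \<open>P\<close> is the out-neighbourhood of the last vertex \<open>f\<close>, and \<open>B\<close> marks
  the bad vertices (neither good nor out-neighbours) together with \<open>f\<close> itself.\<close>

locale marked_order =
  fixes T :: "'a \<Rightarrow> 'a \<Rightarrow> bool" and L :: "'a list" and P B :: "'a \<Rightarrow> bool"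
  assumes dist: "distinct L"
    and asym: "u \<in> set L \<Longrightarrow> v \<in> set L \<Longrightarrow> T u v \<Longrightarrow> \<not> T v u"
    and median: "locally_median T L"
    and disj: "B v \<Longrightarrow> \<not> P v"
    and mark: "L = ys @ b # zs \<Longrightarrow> B b \<Longrightarrow> u \<in> set ys \<Longrightarrow> P u \<Longrightarrow> T b u"
begin

abbreviation "Q v \<equiv> \<not> P v \<and> \<not> B v"

text \<open>Cut \<open>ys\<close> at its last marked vertex and use induction on both pieces. In a
  block without marked vertices, \<open>b\<close> dominates every \<open>P\<close>-vertex, the
  median property yields at least as many in-neighbours of \<open>b\<close>, and these lie in
  \<open>Q\<close>.\<close>

lemma count_le_before_marked:
  assumes "L = xs @ ys @ b # zs" "B b"
  shows "length (filter P ys) \<le> length (filter Q ys)"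
  using assms
proof (induction ys arbitrary: xs b zs rule: length_induct)
  case (1 ys)
  show ?case
  proof (cases "\<exists>c\<in>set ys. B c")
    case True
    then obtain ys1 c I where ys: "ys = ys1 @ c # I" and c: "B c"
      using split_list_last_prop[of ys B] by blast
    have "length (filter P ys1) \<le> length (filter Q ys1)"
    proof -
      have "length ys1 < length ys" "L = xs @ ys1 @ c # (I @ b # zs)"
        using ys 1(2) by auto
      then show ?thesis using 1(1) c by blast
    qed
    moreover have "length (filter P I) \<le> length (filter Q I)"
    proof -
      have "length I < length ys" "L = (xs @ ys1 @ [c]) @ I @ b # zs"
        using ys 1(2) by auto
      then show ?thesis using 1(1,3) by blast
    qed
    ultimately show ?thesis using ys c disj[of c] by simp
  next
    case False
    have T: "T b u" if "u \<in> set ys" "P u" for u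
      using mark[of "xs @ ys" b zs u] that 1(2,3) by simp
    have "length (filter P ys) \<le> length (filter (T b) ys)"
      using T by (intro length_filter_mono) auto
    also have "\<dots> \<le> length (filter (\<lambda>u. T u b) ys)"
      using median 1(2) unfolding locally_median_def by blast
    also have "\<dots> \<le> length (filter Q ys)"
    proof (rule length_filter_mono)
      fix u assume u: "u \<in> set ys" "T u b"
      then have "\<not> P u" using T[of u] asym[of u b] 1(2) by auto
      then show "Q u" using False u by auto
    qed
    finally show ?thesis .
  qed
qed

text \<open>Marked vertices are brought forward one at a time. Each passes unmarked vertices only,
  losing at most as many forward arcs as there are \<open>Q\<close>-vertices before it and gaining
  at least as many as there are \<open>P\<close>-vertices; \<open>bal\<close> makes these numbers
  equal.\<close>

lemma fwd_le_sediment: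
  assumes last: "L = M @ [f]" "B f" and eq: "length (filter P M) = length (filter Q M)"
  shows "fwd T L \<le> fwd T (sediment B L)"
proof -
  \<comment> \<open>The parts before \<open>b\<close> and between \<open>b\<close> and
    \<open>f\<close> both satisfy the inequality, so equality before \<open>f\<close> forces
    equality before \<open>b\<close>.\<close>
  have bal: "length (filter P ys) = length (filter Q ys)" if L: "L = ys @ b # zs" and b: "B b" for ys b zs
  proof (cases zs rule: rev_cases)
    case Nil
    then show ?thesis using L last eq by simp
  next
    case (snoc zs' z)
    then have M: "M = ys @ b # zs'" using L last by simp
    have "length (filter P ys) \<le> length (filter Q ys)"
      using count_le_before_marked[of "[]" ys b zs] L b by simp
    moreover have "length (filter P zs') \<le> length (filter Q zs')"
      using count_le_before_marked[of "ys @ [b]" zs' f "[]"] M last by simp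
    ultimately show ?thesis using eq M b disj[of b] by simp
  qed
  have "fwd T us \<le> fwd T (sediment B us)" if "L = us @ vs" for us vs
    using that
  proof (induction us arbitrary: vs rule: rev_induct)
    case Nil
    then show ?case by simp
  next
    case (snoc b us)
    let ?N = "filter (\<lambda>v. \<not> B v) us"
    have IH: "fwd T us \<le> fwd T (filter B us @ ?N)"
      using snoc.IH[of "b # vs"] snoc.prems by (simp add: sediment_def)
    have snoc_le: "fwd T (us @ [b]) \<le> fwd T (filter B us @ ?N @ [b])"
      using IH fwd_snoc[of T us b] fwd_snoc[of T "filter B us @ ?N" b]
        length_filter_split[of "\<lambda>u. T u b" us B] by simp
    show ?case
    proof (cases "B b")
      case False
      then show ?thesis using snoc_le by (simp add: sediment_def)
    next
      case True
      have T: "T b u" if "u \<in> set us" "P u" for u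
        using mark[of us b vs u] that snoc.prems True by simp
      have "length (filter (\<lambda>u. T u b) ?N) \<le> length (filter Q us)"
        unfolding filter_filter
      proof (rule length_filter_mono)
        fix u assume u: "u \<in> set us" "\<not> B u \<and> T u b"
        then show "Q u" using T[of u] asym[of u b] snoc.prems by auto
      qed
      also have "\<dots> = length (filter P us)"
        using bal[of us b vs] snoc.prems True by simp
      also have "\<dots> \<le> length (filter (T b) ?N)"
        unfolding filter_filter by (rule length_filter_mono) (use T disj in auto)
      finally show ?thesis
        using snoc_le fwd_move[of T "filter B us" ?N b "[]"] True by (simp add: sediment_def)
    qed
  qed
  from this[of L "[]"] show ?thesis by simp
qed

end

section \<open>Good vertices and the last vertex of a median order\<close>

definition before :: "'a list \<Rightarrow> 'a \<Rightarrow> 'a set" where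
  "before L v = set (takeWhile (\<lambda>u. u \<noteq> v) L)"

lemma before_eq: "distinct (ys @ v # zs) \<Longrightarrow> before (ys @ v # zs) v = set ys"
  by (auto simp: before_def takeWhile_append)

lemma last_notin_before:
  assumes "distinct (M @ [f])" "v \<in> set (M @ [f])"
  shows "f \<notin> before (M @ [f]) v"
proof -
  have "before (M @ [f]) v \<subseteq> set M"
    using assms(2) by (cases "v \<in> set M") (auto simp: before_def takeWhile_append dest: set_takeWhileD)
  then show ?thesis using assms(1) by auto
qed

definition good :: "('a \<Rightarrow> 'a \<Rightarrow> bool) \<Rightarrow> 'a list \<Rightarrow> 'a \<Rightarrow> 'a set" where
  "good T L f = {v \<in> set L. v \<noteq> f \<and> \<not> T f v \<and> (\<exists>u \<in> before L v. T f u \<and> T u v)}"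

lemma card_before_sediment:
  assumes L: "distinct L" "v \<in> set L" "\<not> B v" and f: "f \<in> set L" "f \<notin> before L v" "B f"
  shows "card (before L v) < card (before (sediment B L) v)"
proof -
  obtain ys zs where yz: "L = ys @ v # zs" using L(2) split_list by metis
  then have bL: "before L v = set ys" using before_eq L(1) by metis
  let ?S = "filter B L @ filter (\<lambda>v. \<not> B v) ys"
  have d: "distinct (?S @ v # filter (\<lambda>v. \<not> B v) zs)" using L yz by auto
  have "sediment B L = ?S @ v # filter (\<lambda>v. \<not> B v) zs"
    using yz L(3) by (simp add: sediment_def)
  then have bS: "before (sediment B L) v = set ?S" using before_eq[OF d] by simp
  have "set ys \<subset> set ?S" using f bL yz by auto
  then show ?thesis unfolding bL bS by (intro psubset_card_mono) auto
qed

text \<open>Being last in \<open>L\<close>, \<open>f\<close> ends the block of marked vertices,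
  which sedimentation puts before all others.\<close>

lemma unmarked_notin_before_sediment:
  assumes "L = M @ [f]" "distinct L" "B f" "\<not> B v"
  shows "v \<notin> before (sediment B L) f"
proof -
  have S: "sediment B L = filter B M @ f # filter (\<lambda>v. \<not> B v) M"
    using assms by (simp add: sediment_def)
  have "distinct (filter B M @ f # filter (\<lambda>v. \<not> B v) M)"
    using assms by auto
  from before_eq[OF this] show ?thesis using assms(4) by (simp add: S)
qed

lemma feed_vertex:
  assumes L: "distinct L" "L = M @ [f]"
    and asym: "\<And>u v. u \<in> set L \<Longrightarrow> v \<in> set L \<Longrightarrow> T u v \<Longrightarrow> \<not> T v u"
    and tot: "\<And>u v. u \<in> set L \<Longrightarrow> v \<in> set L \<Longrightarrow> u \<noteq> v \<Longrightarrow> T u v \<or> T v u"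
    and med: "locally_median T L"
  defines "N \<equiv> {v \<in> set L. T f v}"
  defines "S \<equiv> sediment (\<lambda>v. v \<notin> N \<union> good T L f) L"
  shows "card N \<le> card (good T L f)"
    and "card N = card (good T L f) \<Longrightarrow> fwd T L \<le> fwd T S"
proof -
  let ?B = "\<lambda>v. v \<notin> N \<union> good T L f"
  have fN: "f \<notin> N" using asym[of f f] L unfolding N_def by auto
  interpret marked_order T L "\<lambda>v. v \<in> N" ?B
  proof
    fix ys b zs u assume s: "L = ys @ b # zs" "?B b" "u \<in> set ys" "u \<in> N"
    have "b \<in> set L" "u \<in> set L" using s by auto
    moreover have "u \<noteq> b" using s L by auto
    moreover have "u \<in> before L b" using s L(1) before_eq by metis
    \<comment> \<open>For \<open>b\<close> other than \<open>f\<close>, an arc from \<open>u\<close>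
      to \<open>b\<close> would make \<open>b\<close> good, since \<open>u\<close> is an
      out-neighbour of \<open>f\<close> placed before \<open>b\<close>.\<close>
    ultimately show "T b u"
      using s tot[of u b] fN unfolding N_def good_def by (cases "b = f") auto
  qed (use assms in auto)
  have fB: "?B f" using fN unfolding good_def by auto
  have d: "distinct M" using L by simp
  have cN: "card N = length (filter (\<lambda>v. v \<in> N) M)"
  proof -
    have "N = set (filter (\<lambda>v. v \<in> N) M)" using fN L unfolding N_def by auto
    then show ?thesis using d by (metis distinct_card distinct_filter)
  qed
  have cG: "card (good T L f) = length (filter (\<lambda>v. v \<notin> N \<and> \<not> ?B v) M)"
  proof -
    have "good T L f = set (filter (\<lambda>v. v \<notin> N \<and> \<not> ?B v) M)"
      using L unfolding N_def good_def by auto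
    then show ?thesis using d by (metis (no_types, lifting) distinct_card distinct_filter)
  qed
  show "card N \<le> card (good T L f)"
    unfolding cN cG using count_le_before_marked[of "[]" M f "[]"] L fB by simp
  show "fwd T L \<le> fwd T S" if "card N = card (good T L f)"
    unfolding S_def using fwd_le_sediment[of M f] L fB that unfolding cN cG by simp
qed


section \<open>Comparing and choosing orders\<close>

lemma fwd_mono:
  assumes "distinct L" "\<And>u v. v \<in> set L \<Longrightarrow> u \<in> before L v \<Longrightarrow> T u v \<Longrightarrow> T' u v"
  shows "fwd T L \<le> fwd T' L"
  using assms
proof (induction L rule: rev_induct)
  case Nil
  then show ?case by simp
next
  case (snoc w L)
  have w: "before (L @ [w]) w = set L" using before_eq[of L w "[]"] snoc.prems by simp
  have v: "before (L @ [w]) v = before L v" if "v \<in> set L" for v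
    using that by (simp add: before_def)
  have "fwd T L \<le> fwd T' L"
    using snoc.prems v by (intro snoc.IH) auto
  moreover have "length (filter (\<lambda>u. T u w) L) \<le> length (filter (\<lambda>u. T' u w) L)"
    using snoc.prems(2)[of w] w by (intro length_filter_mono) auto
  ultimately show ?case by (simp add: fwd_snoc)
qed

text \<open>Serves to pick, among the orders with most forward arcs, one with as many vertices as
  possible before \<open>x\<close>.\<close>

lemma ex_lex_max:
  fixes g h :: "'b \<Rightarrow> nat"
  assumes "finite S" "S \<noteq> {}"
  obtains m where "m \<in> S" "\<And>z. z \<in> S \<Longrightarrow> g z \<le> g m"
    "\<And>z. z \<in> S \<Longrightarrow> g m \<le> g z \<Longrightarrow> h z \<le> h m"
proof -
  define S' where "S' = {z \<in> S. g z = Max (g ` S)}"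
  have "Max (g ` S) \<in> g ` S" using assms by (intro Max_in) auto
  then have "S' \<noteq> {}" unfolding S'_def by fastforce
  moreover have "finite S'" using assms by (simp add: S'_def)
  ultimately have "Max (h ` S') \<in> h ` S'" by (intro Max_in) auto
  then obtain m where m: "m \<in> S'" "h m = Max (h ` S')" by auto
  have le: "g z \<le> g m" if "z \<in> S" for z using m that assms by (simp add: S'_def)
  show ?thesis
  proof
    show "m \<in> S" using m by (simp add: S'_def)
    show "g z \<le> g m" if "z \<in> S" for z using le that .
    show "h z \<le> h m" if "z \<in> S" "g m \<le> g z" for z
    proof -
      have "z \<in> S'" using that le[of z] m by (simp add: S'_def)
      then show ?thesis using m assms by (simp add: S'_def)
    qed
  qed
qed

section \<open>Convenient orientations of missing edges\<close>

context oriented_graph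
begin

abbreviation beats (infix "\<leadsto>" 50) where "u \<leadsto> v \<equiv> (u, v) \<in> parcs G"

lemma adjacent: "u \<in> pverts G \<Longrightarrow> v \<in> pverts G \<Longrightarrow> u \<noteq> v \<Longrightarrow> \<not> missing_edge G u v \<Longrightarrow> u \<leadsto> v \<or> v \<leadsto> u"
  by (auto simp: missing_edge_def)

definition reach2 where "reach2 u v \<longleftrightarrow> u \<leadsto> v \<or> (\<exists>w. u \<leadsto> w \<and> w \<leadsto> v)"

lemma reach2_iff:
  "u \<noteq> v \<Longrightarrow> v \<in> out_nbrs G u \<union> second_out_nbrs G u \<longleftrightarrow> reach2 u v"
  by (auto simp: out_nbrs_def second_out_nbrs_def reach2_def in_arcsD2)

definition convenient where "convenient u v \<longleftrightarrow> (\<forall>w. w \<leadsto> u \<longrightarrow> reach2 w v)"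

text \<open>\<open>p\<close> and \<open>q\<close> witness the two failures. An arc between them, or
  their equality, would give one of the forbidden short paths, so \<open>pq\<close> is missing; it
  loses to \<open>uv\<close>.\<close>

lemma not_convenient:
  assumes "missing_edge G u v" "\<not> convenient u v" "\<not> convenient v u"
  obtains p q where "missing_edge G p q" "p \<leadsto> u" "\<not> reach2 p v" "q \<leadsto> v" "\<not> reach2 q u"
proof -
  obtain p q where pq: "p \<leadsto> u" "\<not> reach2 p v" "q \<leadsto> v" "\<not> reach2 q u"
    using assms unfolding convenient_def by blast
  then have "p \<noteq> q" "\<not> p \<leadsto> q" "\<not> q \<leadsto> p" unfolding reach2_def by auto
  then have "missing_edge G p q"
    using pq in_arcsD1 unfolding missing_edge_def by blast
  with pq that show ?thesis by blast
qed

end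

section \<open>Two missing stars and their completion to a tournament\<close>

locale two_missing_stars = oriented_graph G for G :: "'a pair_pre_digraph" +
  fixes A B :: "'a set" and x y :: 'a
  assumes missing_iff: "missing_edge G u v \<longleftrightarrow>
      (u = x \<and> v \<in> A) \<or> (v = x \<and> u \<in> A) \<or> (u = y \<and> v \<in> B) \<or> (v = y \<and> u \<in> B)"
    and disj: "x \<notin> A" "x \<notin> B" "y \<notin> A" "y \<notin> B" "A \<inter> B = {}"
    and xy: "x \<leadsto> y"
    and partner_A: "a \<in> A \<Longrightarrow> \<exists>b\<in>B. loses_to G {a, x} {b, y} \<or> loses_to G {b, y} {a, x}"
    and partner_B: "b \<in> B \<Longrightarrow> \<exists>a\<in>A. loses_to G {a, x} {b, y} \<or> loses_to G {b, y} {a, x}"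
begin

lemma in_verts: "x \<in> pverts G" "y \<in> pverts G" "a \<in> A \<Longrightarrow> a \<in> pverts G" "b \<in> B \<Longrightarrow> b \<in> pverts G"
  using xy in_arcsD1 in_arcsD2 missing_iff[of x a] missing_iff[of y b]
  by (auto simp: missing_edge_def)

text \<open>The arc from \<open>x\<close> to \<open>y\<close> fixes the matching of endpoints:
  \<open>ax\<close> loses to \<open>by\<close> only through \<open>a\<close> to \<open>b\<close> and
  \<open>x\<close> to \<open>y\<close>, and \<open>by\<close> to \<open>ax\<close> only through
  \<open>b\<close> to \<open>x\<close> and \<open>y\<close> to \<open>a\<close>. The other arcs
  follow by adjacency, their reverses being excluded.\<close>

lemma square:
  assumes "a \<in> A" "b \<in> B" "loses_to G {a, x} {b, y} \<or> loses_to G {b, y} {a, x}"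
  shows "y \<leadsto> a \<and> a \<leadsto> b \<and> b \<leadsto> x"
proof -
  have ne: "a \<noteq> b" "a \<noteq> x" "a \<noteq> y" "b \<noteq> x" "b \<noteq> y" "x \<noteq> y"
    using assms disj xy no_loops' by auto
  have nyx: "\<not> y \<leadsto> x" using xy no_digons by blast
  have adj: "a \<leadsto> b \<or> b \<leadsto> a" "a \<leadsto> y \<or> y \<leadsto> a" "b \<leadsto> x \<or> x \<leadsto> b"
    using adjacent[of a b] adjacent[of a y] adjacent[of b x] in_verts assms ne disj missing_iff
    by auto
  from assms(3) show ?thesis
  proof
    assume "loses_to G {a, x} {b, y}"
    then show ?thesis unfolding loses_to_def out_nbrs_def doubleton_eq_iff
      using adj nyx xy in_verts assms(1,2) by auto
  next
    assume "loses_to G {b, y} {a, x}"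
    then show ?thesis unfolding loses_to_def out_nbrs_def doubleton_eq_iff
      using adj nyx xy in_verts assms(1,2) by auto
  qed
qed

lemma square_A: "a \<in> A \<Longrightarrow> y \<leadsto> a" "a \<in> A \<Longrightarrow> \<exists>b. a \<leadsto> b \<and> b \<leadsto> x"
  using square partner_A by blast+

lemma square_B: "b \<in> B \<Longrightarrow> b \<leadsto> x" "b \<in> B \<Longrightarrow> \<exists>a. y \<leadsto> a \<and> a \<leadsto> b"
  using square partner_B by blast+

text \<open>If both orientations of a missing edge are convenient, the one leaving the centre is
  taken.\<close>

definition tour where
  "tour u v \<longleftrightarrow> u \<leadsto> v \<or>
     (v = x \<and> u \<in> A \<and> \<not> convenient x u) \<or> (u = x \<and> v \<in> A \<and> convenient x v) \<or>
     (v = y \<and> u \<in> B \<and> \<not> convenient y u) \<or> (u = y \<and> v \<in> B \<and> convenient y v)"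

lemma tour_total: "u \<in> pverts G \<Longrightarrow> v \<in> pverts G \<Longrightarrow> u \<noteq> v \<Longrightarrow> tour u v \<or> tour v u"
proof (cases "missing_edge G u v")
  case True
  then show ?thesis unfolding missing_iff tour_def by blast
qed (use adjacent tour_def in blast)

lemma tour_missing: "tour u v \<Longrightarrow> u \<leadsto> v \<or> missing_edge G u v"
  unfolding tour_def missing_iff by auto

lemma tour_asym: "tour u v \<Longrightarrow> \<not> tour v u"
proof
  assume t: "tour u v" "tour v u"
  show False
  proof (cases "missing_edge G u v")
    case True
    then have "\<not> u \<leadsto> v" "\<not> v \<leadsto> u" unfolding missing_edge_def by auto
    with True t show False unfolding tour_def missing_iff using disj by auto
  next
    case False
    then have "\<not> missing_edge G v u" unfolding missing_edge_def by auto
    with False t tour_missing no_digons show False by blast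
  qed
qed

text \<open>If the chosen orientation of a missing edge is not convenient,
  \<open>not_convenient\<close> supplies a missing edge \<open>pq\<close> losing to it, and the
  known arcs force \<open>pq\<close> into the other star.\<close>

lemma tour_cases:
  assumes "tour u v" "\<not> u \<leadsto> v"
  obtains "convenient u v"
  | b where "v = x" "u \<in> A" "b \<in> B" "b \<leadsto> x" "\<not> reach2 b u"
  | a where "v = y" "u \<in> B" "a \<in> A" "\<not> reach2 x u"
proof (cases "convenient u v")
  case False
  then consider "v = x" "u \<in> A" "\<not> convenient x u" | "v = y" "u \<in> B" "\<not> convenient y u"
    using assms unfolding tour_def by auto
  then show ?thesis
  proof cases
    case 1
    then have "missing_edge G u x" using missing_iff by auto
    then obtain p q where pq: "missing_edge G p q" "p \<leadsto> u" "\<not> reach2 p x" "q \<leadsto> x" "\<not> reach2 q u"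
      using not_convenient False 1 by metis
    have "\<not> x \<leadsto> u" "\<not> x \<leadsto> x" "\<not> y \<leadsto> x"
      using \<open>missing_edge G u x\<close> no_loops' no_digons xy unfolding missing_edge_def by auto
    then have "q \<in> B" using pq missing_iff by auto
    then show ?thesis using that(2) 1 pq by blast
  next
    case 2
    then have "missing_edge G u y" using missing_iff by auto
    then obtain p q where pq: "missing_edge G p q" "p \<leadsto> u" "\<not> reach2 p y" "q \<leadsto> y" "\<not> reach2 q u"
      using not_convenient False 2 by metis
    have "\<not> y \<leadsto> u" "\<not> y \<leadsto> y" "\<not> x \<leadsto> u"
      using \<open>missing_edge G u y\<close> no_loops' no_digons square_B 2 unfolding missing_edge_def by auto
    then have "p \<in> A" "q = x" using pq missing_iff by auto
    then show ?thesis using that(3) 2 pq by blast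
  qed
qed (use that in blast)

section \<open>Redirecting missing edges, and the contradiction by sedimentation\<close>

definition toward where
  "toward f u v \<longleftrightarrow> (if u = f then f \<leadsto> v else if v = f then \<not> f \<leadsto> u else tour u v)"

text \<open>Passing from \<open>tour\<close> to \<open>toward f\<close> reverses only missing edges
  that leave \<open>f\<close>.\<close>

lemma tour_imp_toward: "tour u v \<Longrightarrow> u \<noteq> f \<Longrightarrow> toward f u v"
  using tour_asym[of u v] unfolding toward_def by (auto simp: tour_def)

lemma toward_imp_tour: "toward f u v \<Longrightarrow> v \<noteq> f \<Longrightarrow> tour u v"
  unfolding toward_def tour_def by (auto split: if_splits)

lemma toward_total: "u \<in> pverts G \<Longrightarrow> v \<in> pverts G \<Longrightarrow> u \<noteq> v \<Longrightarrow> toward f u v \<or> toward f v u"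
  using tour_total[of u v] unfolding toward_def by auto

lemma toward_asym: "toward f u v \<Longrightarrow> \<not> toward f v u"
  unfolding toward_def by (metis tour_asym no_loops')

text \<open>If \<open>uv\<close> is a convenient missing edge, \<open>f\<close> reaches
  \<open>v\<close> as an in-neighbour of \<open>u\<close>. Otherwise compare \<open>f\<close> with
  \<open>b\<close> (if \<open>v = x\<close>) or with \<open>x\<close> (if \<open>v = y\<close>): an
  arc into \<open>f\<close> would continue to \<open>u\<close> against \<open>tour_cases\<close>, so
  \<open>f\<close> dominates that vertex, which dominates \<open>x\<close> or leads to
  \<open>y\<close>. The exceptions arise where this pair is itself missing.\<close>

lemma toward_second:
  assumes f: "f \<in> pverts G" and v: "v \<in> pverts G" "v \<noteq> f" "\<not> f \<leadsto> v" and u: "f \<leadsto> u" "toward f u v"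
    and A: "f \<in> A \<Longrightarrow> v \<noteq> y" and y: "f = y \<Longrightarrow> v \<noteq> x"
  shows "v \<in> second_out_nbrs G f"
proof -
  have "reach2 f v"
  proof (cases "u \<leadsto> v")
    case True
    then show ?thesis using u unfolding reach2_def by auto
  next
    case False
    have fu: "u \<noteq> f" using u no_loops' by auto
    then have "tour u v" using u v unfolding toward_def by auto
    then show ?thesis
      using False
    proof (cases rule: tour_cases)
      case 1
      then show ?thesis using u unfolding convenient_def by auto
    next
      case (2 b)
      show ?thesis
      proof (cases "f \<in> A \<or> f \<in> B")
        case True
        then show ?thesis using 2 square_A square_B unfolding reach2_def by blast
      next
        case False
        then have "f \<leadsto> b \<or> b \<leadsto> f"
          using adjacent[of f b] missing_iff[of f b] f in_verts 2 v y by auto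
        then show ?thesis using 2 u unfolding reach2_def by blast
      qed
    next
      case (3 a)
      show ?thesis
      proof (cases "f = x \<or> f \<in> B")
        case True
        then show ?thesis using 3 square_B xy unfolding reach2_def by blast
      next
        case False
        then have "f \<leadsto> x \<or> x \<leadsto> f"
          using adjacent[of f x] missing_iff[of f x] f in_verts 3 v A disj by auto
        then show ?thesis using 3 u xy unfolding reach2_def by blast
      qed
    qed
  qed
  then show ?thesis using v unfolding second_out_nbrs_def reach2_def by auto
qed

lemma satisfies_SNC: "satisfies_SNC G"
proof (rule ccontr)
  assume "\<not> satisfies_SNC G"
  then have less: "card (second_out_nbrs G f) < card (out_nbrs G f)" if "f \<in> pverts G" for f
    using that unfolding satisfies_SNC_def by force
  let ?S = "{L. distinct L \<and> set L = pverts G}"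
  have "finite ?S"
    by (rule finite_subset[OF _ finite_subset_distinct[OF pair_finite_verts]]) auto
  moreover have "?S \<noteq> {}" using finite_distinct_list[OF pair_finite_verts] by auto
  ultimately obtain L where L: "L \<in> ?S" and max: "\<And>L'. L' \<in> ?S \<Longrightarrow> fwd tour L' \<le> fwd tour L"
    and far: "\<And>L'. L' \<in> ?S \<Longrightarrow> fwd tour L \<le> fwd tour L' \<Longrightarrow> card (before L' x) \<le> card (before L x)"
    using ex_lex_max[of ?S "fwd tour" "\<lambda>L. card (before L x)"] by blast
  have dL: "distinct L" and sL: "set L = pverts G" using L by auto
  have med: "locally_median tour L"
    using fwd_max_imp_locally_median[of L tour] max dL sL by auto
  obtain M f where LM: "L = M @ [f]" using sL in_verts(1) by (cases L rule: rev_cases) auto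
  then have f: "f \<in> pverts G" and fM: "f \<notin> set M" using sL dL by auto
  let ?T = "toward f"
  \<comment> \<open>The block \<open>ys\<close> is followed by \<open>v\<close>, so it avoids the
    last vertex \<open>f\<close>; redirection can then only help the inequality.\<close>
  have "locally_median ?T L"
    unfolding locally_median_def
  proof (intro allI impI)
    fix xs ys v zs assume s: "L = xs @ ys @ v # zs"
    have vys: "v \<notin> set ys" using s dL by auto
    have "f \<notin> set ys" using s LM dL by (cases zs rule: rev_cases) auto
    then have t: "?T v w \<Longrightarrow> tour v w" "tour w v \<Longrightarrow> ?T w v" if "w \<in> set ys" for w
    proof -
      have "w \<noteq> f" using that \<open>f \<notin> set ys\<close> by auto
      then show "?T v w \<Longrightarrow> tour v w" "tour w v \<Longrightarrow> ?T w v"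
        using toward_imp_tour tour_imp_toward by auto
    qed
    have "length (filter (?T v) ys) \<le> length (filter (tour v) ys)"
      using t by (intro length_filter_mono) auto
    also have "\<dots> \<le> length (filter (\<lambda>u. tour u v) ys)"
      using med s unfolding locally_median_def by blast
    also have "\<dots> \<le> length (filter (\<lambda>u. ?T u v) ys)"
      using t by (intro length_filter_mono) auto
    finally show "length (filter (?T v) ys) \<le> length (filter (\<lambda>u. ?T u v) ys)" .
  qed
  note fd = feed_vertex[OF dL LM toward_asym toward_total this, unfolded sL]
  let ?N = "{v \<in> pverts G. ?T f v}" and ?G = "good ?T L f"
  let ?B = "\<lambda>v. v \<notin> ?N \<union> ?G"
  let ?L = "sediment ?B L"
  have N: "?N = out_nbrs G f" by (auto simp: toward_def out_nbrs_def)
  have le: "card ?N \<le> card ?G" and eq: "card ?N = card ?G \<Longrightarrow> fwd ?T L \<le> fwd ?T ?L"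
    using fd by auto
  have good_second: "v \<in> second_out_nbrs G f"
    if "v \<in> ?G" "f \<in> A \<Longrightarrow> v \<noteq> y" "f = y \<Longrightarrow> v \<noteq> x" for v
    using toward_second[OF f, of v] that sL unfolding good_def by (auto simp: toward_def)
  have fin: "finite (second_out_nbrs G f)" "finite ?G"
    using pair_finite_verts unfolding second_out_nbrs_def good_def by auto
  \<comment> \<open>The only vertex that can be good without being a second out-neighbour of
    \<open>f\<close>.\<close>
  define z where "z = (if f = y then x else y)"
  have sub: "?G \<subseteq> insert z (second_out_nbrs G f)"
    using good_second disj unfolding z_def by auto
  have fA: "f \<in> A \<or> f = y"
  proof (rule ccontr)
    assume "\<not> ?thesis"
    then have "?G \<subseteq> second_out_nbrs G f" using good_second by auto
    then have "card ?G \<le> card (second_out_nbrs G f)" using fin card_mono by blast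
    then show False using le less[OF f] N by simp
  qed
  \<comment> \<open>The out-degree exceeds the second out-degree, is at most the number of good
    vertices, and that number is at most the second out-degree plus one; so every bound is
    tight.\<close>
  have z: "z \<in> ?G" and second: "second_out_nbrs G f \<subseteq> ?G" and cG: "card ?G = card ?N"
  proof -
    have lt: "card (second_out_nbrs G f) < card ?G" using le less[OF f] N by simp
    show z: "z \<in> ?G"
    proof (rule ccontr)
      assume "z \<notin> ?G"
      then have "?G \<subseteq> second_out_nbrs G f" using sub by auto
      then show False using lt fin card_mono by (metis not_le)
    qed
    have "card ?G \<le> card (insert z (second_out_nbrs G f))"
      using sub fin(1) by (intro card_mono) auto
    then have c: "card ?G \<le> Suc (card (second_out_nbrs G f))"
      using fin(1) by (simp add: card_insert_if split: if_splits)
    show "card ?G = card ?N" using c le less[OF f] N by simp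
    show "second_out_nbrs G f \<subseteq> ?G"
    proof (rule ccontr)
      assume "\<not> ?thesis"
      then obtain w where w: "w \<in> second_out_nbrs G f" "w \<notin> ?G" by auto
      then have "?G \<subseteq> insert z (second_out_nbrs G f - {w})" using sub by auto
      then have "card ?G \<le> card (insert z (second_out_nbrs G f - {w}))"
        using fin by (intro card_mono) auto
      also have "\<dots> \<le> Suc (card (second_out_nbrs G f - {w}))" using fin(1) by (simp add: card_insert_if)
      also have "\<dots> = card (second_out_nbrs G f)" using card_Suc_Diff1 fin(1) w(1) by metis
      finally show False using lt by simp
    qed
  qed
  \<comment> \<open>The squares give paths \<open>a\<close>, \<open>b\<close>, \<open>x\<close> and
    \<open>y\<close>, \<open>a\<close>, \<open>b\<close>, so the missing neighbours of
    \<open>f\<close> are second out-neighbours and hence good.\<close>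
  have nbr: "w \<in> ?G" if "missing_edge G w f" for w
  proof -
    have "(f \<in> A \<and> w = x) \<or> (f = y \<and> w \<in> B)"
      using that[unfolded missing_iff] fA disj no_loops'[OF xy] by auto
    then consider "f \<in> A" "w = x" | "f = y" "w \<in> B" by blast
    then show ?thesis
    proof cases
      case 1
      then have "x \<in> second_out_nbrs G f"
        using that square_A(2)[of f] in_verts unfolding second_out_nbrs_def missing_edge_def by blast
      then show ?thesis using second 1 by auto
    next
      case 2
      then have "w \<in> second_out_nbrs G f"
        using that square_B(2)[of w] in_verts unfolding second_out_nbrs_def missing_edge_def by blast
      then show ?thesis using second by auto
    qed
  qed
  have x: "x \<in> ?G" using fA z nbr missing_iff unfolding z_def by auto
  have fB: "?B f" using no_loops' by (auto simp: good_def toward_def)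
  have S: "?L \<in> ?S" using dL sL by (auto simp: sediment_def)
  have "fwd tour L \<le> fwd ?T L"
  proof (rule fwd_mono[OF dL])
    fix u v assume uv: "v \<in> set L" "u \<in> before L v" "tour u v"
    then have "u \<noteq> f" using last_notin_before dL unfolding LM by metis
    with uv show "?T u v" using tour_imp_toward by blast
  qed
  also have "\<dots> \<le> fwd ?T ?L" using eq cG by simp
  \<comment> \<open>Missing neighbours of \<open>f\<close> are unmarked and now follow
    \<open>f\<close>, so no redirected edge counts as a forward arc.\<close>
  also have "\<dots> \<le> fwd tour ?L"
  proof (rule fwd_mono)
    show "distinct ?L" using S by auto
    fix u v assume uv: "v \<in> set ?L" "u \<in> before ?L v" "?T u v"
    have u: "u \<in> pverts G" "u \<noteq> v"
      using uv(2) S by (auto simp: before_def dest: set_takeWhileD)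
    show "tour u v"
    proof (cases "v = f")
      case False
      then show ?thesis using uv toward_imp_tour by blast
    next
      case True
      have "\<not> missing_edge G u f"
      proof
        assume "missing_edge G u f"
        then have "\<not> ?B u" using nbr by auto
        from unmarked_notin_before_sediment[where B = ?B, OF LM dL fB this] uv(2) True show False by auto
      qed
      moreover have "\<not> f \<leadsto> u" using uv(3) True u unfolding toward_def by auto
      ultimately show ?thesis using adjacent[of u f] u f True unfolding tour_def by auto
    qed
  qed
  finally have "card (before ?L x) \<le> card (before L x)" using far S by auto
  moreover have "f \<notin> before L x"
    using last_notin_before dL sL in_verts(1) unfolding LM by metis
  then have "card (before L x) < card (before ?L x)"
    using card_before_sediment[of L x ?B f] dL sL in_verts x f fB by auto
  ultimately show False by simp
qed

end

section \<open>Reduction to the two-star setting\<close>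

theorem theorem4:
  fixes D :: "'a pair_pre_digraph"
  assumes "oriented_graph D"
    and "missing_two_disjoint_stars D"
    and "\<not> (\<exists>e. isolated_vertex (dependency_digraph D) e)"
  shows "satisfies_SNC D"
proof -
  interpret oriented_graph D by fact
  obtain x y S T where st: "star_of_center x S" "star_of_center y T" "fst S \<inter> fst T = {}"
    and mg: "missing_graph D = (fst S \<union> fst T, snd S \<union> snd T)"
    using assms(2) unfolding missing_two_disjoint_stars_def by blast
  obtain A where A: "x \<notin> A" "S = (insert x A, {{a, x} | a. a \<in> A})"
    using st(1) unfolding star_of_center_def by blast
  obtain B where B: "y \<notin> B" "T = (insert y B, {{b, y} | b. b \<in> B})"
    using st(2) unfolding star_of_center_def by blast
  have d: "x \<notin> A" "y \<notin> B" "insert x A \<inter> insert y B = {}"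
    using st(3) A B by simp_all
  have mg: "missing_graph D = (insert x A \<union> insert y B, {{a, x} | a. a \<in> A} \<union> {{b, y} | b. b \<in> B})"
    using mg A B by simp
  have me: "missing_edges D = {{a, x} | a. a \<in> A} \<union> {{b, y} | b. b \<in> B}"
    using mg unfolding missing_graph_def by simp
  have verts: "x \<in> pverts D" "y \<in> pverts D"
    using mg unfolding missing_graph_def by auto
  have sym: "missing_edge D u v \<longleftrightarrow> missing_edge D v u" for u v
    unfolding missing_edge_def by auto
  have miss: "missing_edge D u v \<longleftrightarrow>
      (u = x \<and> v \<in> A) \<or> (v = x \<and> u \<in> A) \<or> (u = y \<and> v \<in> B) \<or> (v = y \<and> u \<in> B)" for u v
  proof -
    have "missing_edge D u v \<longleftrightarrow> {u, v} \<in> missing_edges D"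
      unfolding missing_edges_def using sym by (auto simp: doubleton_eq_iff)
    also have "\<dots> \<longleftrightarrow> (u = x \<and> v \<in> A) \<or> (v = x \<and> u \<in> A) \<or> (u = y \<and> v \<in> B) \<or> (v = y \<and> u \<in> B)"
      unfolding me by (auto simp: doubleton_eq_iff)
    finally show ?thesis .
  qed
  have partner: "\<exists>e'\<in>missing_edges D. loses_to D e e' \<or> loses_to D e' e" if "e \<in> missing_edges D" for e
  proof (rule ccontr)
    assume "\<not> ?thesis"
    then have "in_arcs (with_proj (dependency_digraph D)) e = {}"
      "out_arcs (with_proj (dependency_digraph D)) e = {}"
      by (auto simp: in_arcs_def out_arcs_def dependency_digraph_def)
    then have "isolated_vertex (dependency_digraph D) e"
      using that by (simp add: isolated_vertex_def in_degree_def out_degree_def dependency_digraph_def)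
    then show False using assms(3) by blast
  qed
  \<comment> \<open>The shared centre would be matched with itself, giving a loop, or with a leaf,
    giving an arc on a missing edge.\<close>
  have same_star: "\<not> loses_to D {a, c} {a', c}" if "\<And>a. a \<in> C \<Longrightarrow> missing_edge D a c" "a \<in> C" "a' \<in> C" for a a' c C
    using that no_loops' sym unfolding loses_to_def doubleton_eq_iff missing_edge_def by blast
  have nA: "\<not> loses_to D {a, x} {a', x}" if "a \<in> A" "a' \<in> A" for a a'
    using that miss by (intro same_star[of A]) auto
  have nB: "\<not> loses_to D {b, y} {b', y}" if "b \<in> B" "b' \<in> B" for b b'
    using that miss by (intro same_star[of B]) auto
  have pA: "\<exists>b\<in>B. loses_to D {a, x} {b, y} \<or> loses_to D {b, y} {a, x}" if "a \<in> A" for a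
  proof -
    have "{a, x} \<in> missing_edges D" using me that by blast
    from partner[OF this] show ?thesis using nA that unfolding me by blast
  qed
  have pB: "\<exists>a\<in>A. loses_to D {b, y} {a, x} \<or> loses_to D {a, x} {b, y}" if "b \<in> B" for b
  proof -
    have "{b, y} \<in> missing_edges D" using me that by blast
    from partner[OF this] show ?thesis using nB that unfolding me by blast
  qed
  have "x \<noteq> y" "\<not> missing_edge D x y" using d miss by auto
  with adjacent verts have arc: "(x, y) \<in> parcs D \<or> (y, x) \<in> parcs D" by blast
  have pA': "\<exists>b\<in>B. loses_to D {b, y} {a, x} \<or> loses_to D {a, x} {b, y}" if "a \<in> A" for a
    using pA[OF that] by blast
  have pB': "\<exists>a\<in>A. loses_to D {a, x} {b, y} \<or> loses_to D {b, y} {a, x}" if "b \<in> B" for b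
    using pB[OF that] by blast
  from arc show ?thesis
  proof
    assume xy: "(x, y) \<in> parcs D"
    interpret two_missing_stars D A B x y
      by unfold_locales (fact miss pA pB' xy | use d in blast)+
    show ?thesis by (rule satisfies_SNC)
  next
    assume yx: "(y, x) \<in> parcs D"
    \<comment> \<open>The stars exchange roles, so the arc again runs from the first centre to the
      second.\<close>
    interpret two_missing_stars D B A y x
    proof unfold_locales
      show "missing_edge D u v \<longleftrightarrow>
        (u = y \<and> v \<in> B) \<or> (v = y \<and> u \<in> B) \<or> (u = x \<and> v \<in> A) \<or> (v = x \<and> u \<in> A)" for u v
        unfolding miss by blast
    qed (fact pA' pB yx | use d in blast)+
    show ?thesis by (rule satisfies_SNC)
  qed
qed

end
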